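(* Let $R$ be a commutative ring and let $\mathcal{D}$ be a karoubian additive $R$-linear category with weak kernels and weak cokernels. Let $\mathcal{S}\subseteq\mathcal{D}$ be a full subcategory which is closed under weak cokernels and direct summands. If $\mathcal{S}$ is precovering, then $\mathcal{S}$ is coreflective.
   Context: A category is karoubian if every idempotent endomorphism splits. A weak kernel of $Y\to Z$ is a map $X\to Y$ such that $\mathcal{D}(-,X)\to\mathcal{D}(-,Y)\to\mathcal{D}(-,Z)$ is exact; weak cokernels are defined dually. That $\mathcal{S}$ is closed under weak cokernels means that every map in $\mathcal{S}$ admits a weak cokernel in $\mathcal{D}$ whose target lies in $\mathcal{S}$. An $\mathcal{S}$-precover of $D\in\mathcal{D}$ is a morphism $S\to D$ with $S\in\mathcal{S}$ such that $\mathcal{D}(X,S)\to\mathcal{D}(X,D)$ is surjective for all $X\in\mathcal{S}$; $\mathcal{S}$ is precovering if every $D\in\mathcal{D}$ has an $\mathcal{S}$-precover. $\mathcal{S}$ is coreflective if the inclusion functor $\mathcal{S}\to\mathcal{D}$ has a right adjoint. *)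

theory Defs
  imports "HOL-Algebra.AbelCoset" "HOL-Algebra.Module"
begin

text \<open>Morphism sets are a family indexed by source and target and are not assumed disjoint;
  hence composition takes the three objects involved as arguments, and
  \<open>Cmp C X Y Z g f\<close> is the composite of \<open>f : X \<rightarrow> Y\<close> followed by \<open>g : Y \<rightarrow> Z\<close>.\<close>

record ('o, 'm) category =
  Obj :: "'o set"
  Mor :: "'o \<Rightarrow> 'o \<Rightarrow> 'm set"
  Cmp :: "'o \<Rightarrow> 'o \<Rightarrow> 'o \<Rightarrow> 'm \<Rightarrow> 'm \<Rightarrow> 'm"
  Idn :: "'o \<Rightarrow> 'm"

locale category =
  fixes C :: "('o, 'm, 'z) category_scheme"
  assumes Idn_closed: "X \<in> Obj C \<Longrightarrow> Idn C X \<in> Mor C X X"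
    and Cmp_closed:
      "\<lbrakk>X \<in> Obj C; Y \<in> Obj C; Z \<in> Obj C; f \<in> Mor C X Y; g \<in> Mor C Y Z\<rbrakk>
        \<Longrightarrow> Cmp C X Y Z g f \<in> Mor C X Z"
    and Cmp_Idn_left:
      "\<lbrakk>X \<in> Obj C; Y \<in> Obj C; f \<in> Mor C X Y\<rbrakk> \<Longrightarrow> Cmp C X Y Y (Idn C Y) f = f"
    and Cmp_Idn_right:
      "\<lbrakk>X \<in> Obj C; Y \<in> Obj C; f \<in> Mor C X Y\<rbrakk> \<Longrightarrow> Cmp C X X Y f (Idn C X) = f"
    and Cmp_assoc:
      "\<lbrakk>W \<in> Obj C; X \<in> Obj C; Y \<in> Obj C; Z \<in> Obj C;
        f \<in> Mor C W X; g \<in> Mor C X Y; h \<in> Mor C Y Z\<rbrakk>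
        \<Longrightarrow> Cmp C W X Z (Cmp C X Y Z h g) f = Cmp C W Y Z h (Cmp C W X Y g f)"

record ('o, 'm, 'p, 'n) cfunctor =
  FObj :: "'o \<Rightarrow> 'p"
  FMor :: "'o \<Rightarrow> 'o \<Rightarrow> 'm \<Rightarrow> 'n"

locale cfunctor = C: category C + D: category D
  for C :: "('o, 'm, 'y) category_scheme" and D :: "('p, 'n, 'z) category_scheme" +
  fixes F :: "('o, 'm, 'p, 'n) cfunctor"
  assumes FObj_closed: "X \<in> Obj C \<Longrightarrow> FObj F X \<in> Obj D"
    and FMor_closed:
      "\<lbrakk>X \<in> Obj C; Y \<in> Obj C; f \<in> Mor C X Y\<rbrakk>
        \<Longrightarrow> FMor F X Y f \<in> Mor D (FObj F X) (FObj F Y)"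
    and FMor_Idn: "X \<in> Obj C \<Longrightarrow> FMor F X X (Idn C X) = Idn D (FObj F X)"
    and FMor_Cmp:
      "\<lbrakk>X \<in> Obj C; Y \<in> Obj C; Z \<in> Obj C; f \<in> Mor C X Y; g \<in> Mor C Y Z\<rbrakk>
        \<Longrightarrow> FMor F X Z (Cmp C X Y Z g f)
            = Cmp D (FObj F X) (FObj F Y) (FObj F Z) (FMor F Y Z g) (FMor F X Y f)"

text \<open>An adjunction \<open>F \<stileturn> G\<close> is a family of bijections
  \<open>\<phi> X Y : D(F X, Y) \<rightarrow> C(X, G Y)\<close> natural in \<open>X\<close> and in \<open>Y\<close>.\<close>

locale adjunction = F: cfunctor C D F + G: cfunctor D C G
  for C :: "('o, 'm, 'y) category_scheme" and D :: "('p, 'n, 'z) category_scheme"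
    and F :: "('o, 'm, 'p, 'n) cfunctor" and G :: "('p, 'n, 'o, 'm) cfunctor" +
  fixes \<phi> :: "'o \<Rightarrow> 'p \<Rightarrow> 'n \<Rightarrow> 'm"
  assumes bij:
      "\<lbrakk>X \<in> Obj C; Y \<in> Obj D\<rbrakk>
        \<Longrightarrow> bij_betw (\<phi> X Y) (Mor D (FObj F X) Y) (Mor C X (FObj G Y))"
    and natural_left:
      "\<lbrakk>X' \<in> Obj C; X \<in> Obj C; Y \<in> Obj D; u \<in> Mor C X' X; h \<in> Mor D (FObj F X) Y\<rbrakk>
        \<Longrightarrow> \<phi> X' Y (Cmp D (FObj F X') (FObj F X) Y h (FMor F X' X u))
            = Cmp C X' X (FObj G Y) (\<phi> X Y h) u"
    and natural_right:
      "\<lbrakk>X \<in> Obj C; Y \<in> Obj D; Y' \<in> Obj D; h \<in> Mor D (FObj F X) Y; v \<in> Mor D Y Y'\<rbrakk>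
        \<Longrightarrow> \<phi> X Y' (Cmp D (FObj F X) Y Y' v h)
            = Cmp C X (FObj G Y) (FObj G Y') (FMor G Y Y' v) (\<phi> X Y h)"

definition has_right_adjoint ::
  "('o, 'm, 'y) category_scheme \<Rightarrow> ('p, 'n, 'z) category_scheme
    \<Rightarrow> ('o, 'm, 'p, 'n) cfunctor \<Rightarrow> bool"
  where "has_right_adjoint C D F \<longleftrightarrow> (\<exists>G \<phi>. adjunction C D F G \<phi>)"

definition full_subcategory ::
  "('o, 'm, 'z) category_scheme \<Rightarrow> 'o set \<Rightarrow> ('o, 'm, 'z) category_scheme"
  where "full_subcategory D S = D\<lparr>Obj := S\<rparr>"

definition inclusion_functor :: "('o, 'm, 'o, 'm) cfunctor"
  where "inclusion_functor = \<lparr>FObj = (\<lambda>X. X), FMor = (\<lambda>X Y f. f)\<rparr>"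

definition coreflective :: "('o, 'm, 'z) category_scheme \<Rightarrow> 'o set \<Rightarrow> bool"
  where "coreflective D S \<longleftrightarrow> has_right_adjoint (full_subcategory D S) D inclusion_functor"

definition splits :: "('o, 'm, 'z) category_scheme \<Rightarrow> 'o \<Rightarrow> 'm \<Rightarrow> bool"
  where "splits D X e \<longleftrightarrow>
    (\<exists>Y\<in>Obj D. \<exists>r\<in>Mor D X Y. \<exists>s\<in>Mor D Y X.
      Cmp D X Y X s r = e \<and> Cmp D Y X Y r s = Idn D Y)"

definition karoubian :: "('o, 'm, 'z) category_scheme \<Rightarrow> bool"
  where "karoubian D \<longleftrightarrow>
    (\<forall>X\<in>Obj D. \<forall>e\<in>Mor D X X. Cmp D X X X e e = e \<longrightarrow> splits D X e)"

definition is_precover ::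
  "('o, 'm, 'z) category_scheme \<Rightarrow> 'o set \<Rightarrow> 'o \<Rightarrow> 'o \<Rightarrow> 'm \<Rightarrow> bool"
  where "is_precover D S A Y p \<longleftrightarrow>
    A \<in> S \<and> p \<in> Mor D A Y \<and> (\<forall>X\<in>S. (\<lambda>f. Cmp D X A Y p f) ` Mor D X A = Mor D X Y)"

definition precovering :: "('o, 'm, 'z) category_scheme \<Rightarrow> 'o set \<Rightarrow> bool"
  where "precovering D S \<longleftrightarrow> (\<forall>Y\<in>Obj D. \<exists>A p. is_precover D S A Y p)"

definition is_zero_object :: "('o, 'm, 'z) category_scheme \<Rightarrow> 'o \<Rightarrow> bool"
  where "is_zero_object D Z \<longleftrightarrow>
    Z \<in> Obj D \<and> (\<forall>X\<in>Obj D. (\<exists>!f. f \<in> Mor D X Z) \<and> (\<exists>!f. f \<in> Mor D Z X))"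

text \<open>The multiplicative fields \<open>mult\<close> and \<open>one\<close> that a \<open>module\<close> record inherits from
  the record type of rings are not used.\<close>

record ('o, 'm, 'r) linear_category = "('o, 'm) category" +
  HomMod :: "'o \<Rightarrow> 'o \<Rightarrow> ('r, 'm) module"

locale linear_category = R: cring R + category D
  for R :: "('r, 'b) ring_scheme" and D :: "('o, 'm, 'r, 'z) linear_category_scheme" +
  assumes HomMod_module: "\<lbrakk>X \<in> Obj D; Y \<in> Obj D\<rbrakk> \<Longrightarrow> Module.module R (HomMod D X Y)"
    and carrier_HomMod: "\<lbrakk>X \<in> Obj D; Y \<in> Obj D\<rbrakk> \<Longrightarrow> carrier (HomMod D X Y) = Mor D X Y"
    and Cmp_add_left:
      "\<lbrakk>X \<in> Obj D; Y \<in> Obj D; Z \<in> Obj D; f \<in> Mor D X Y; g \<in> Mor D Y Z; h \<in> Mor D Y Z\<rbrakk>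
        \<Longrightarrow> Cmp D X Y Z (g \<oplus>\<^bsub>HomMod D Y Z\<^esub> h) f
            = Cmp D X Y Z g f \<oplus>\<^bsub>HomMod D X Z\<^esub> Cmp D X Y Z h f"
    and Cmp_add_right:
      "\<lbrakk>X \<in> Obj D; Y \<in> Obj D; Z \<in> Obj D; f \<in> Mor D X Y; g \<in> Mor D X Y; h \<in> Mor D Y Z\<rbrakk>
        \<Longrightarrow> Cmp D X Y Z h (f \<oplus>\<^bsub>HomMod D X Y\<^esub> g)
            = Cmp D X Y Z h f \<oplus>\<^bsub>HomMod D X Z\<^esub> Cmp D X Y Z h g"
    and Cmp_smult_left:
      "\<lbrakk>X \<in> Obj D; Y \<in> Obj D; Z \<in> Obj D; a \<in> carrier R; f \<in> Mor D X Y; g \<in> Mor D Y Z\<rbrakk>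
        \<Longrightarrow> Cmp D X Y Z (a \<odot>\<^bsub>HomMod D Y Z\<^esub> g) f = a \<odot>\<^bsub>HomMod D X Z\<^esub> Cmp D X Y Z g f"
    and Cmp_smult_right:
      "\<lbrakk>X \<in> Obj D; Y \<in> Obj D; Z \<in> Obj D; a \<in> carrier R; f \<in> Mor D X Y; g \<in> Mor D Y Z\<rbrakk>
        \<Longrightarrow> Cmp D X Y Z g (a \<odot>\<^bsub>HomMod D X Y\<^esub> f) = a \<odot>\<^bsub>HomMod D X Z\<^esub> Cmp D X Y Z g f"

definition is_biproduct :: "('o, 'm, 'r, 'z) linear_category_scheme \<Rightarrow> 'o \<Rightarrow> 'o \<Rightarrow> 'o \<Rightarrow> bool"
  where "is_biproduct D X Y B \<longleftrightarrow>
    X \<in> Obj D \<and> Y \<in> Obj D \<and> B \<in> Obj D \<and>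
    (\<exists>i\<in>Mor D X B. \<exists>j\<in>Mor D Y B. \<exists>p\<in>Mor D B X. \<exists>q\<in>Mor D B Y.
      Cmp D X B X p i = Idn D X \<and> Cmp D Y B Y q j = Idn D Y \<and>
      Cmp D Y B X p j = \<zero>\<^bsub>HomMod D Y X\<^esub> \<and> Cmp D X B Y q i = \<zero>\<^bsub>HomMod D X Y\<^esub> \<and>
      Cmp D B X B i p \<oplus>\<^bsub>HomMod D B B\<^esub> Cmp D B Y B j q = Idn D B)"

locale additive_linear_category = linear_category +
  assumes zero_object: "\<exists>Z. is_zero_object D Z"
    and biproducts: "\<lbrakk>X \<in> Obj D; Y \<in> Obj D\<rbrakk> \<Longrightarrow> \<exists>B. is_biproduct D X Y B"

text \<open>\<open>f : X \<rightarrow> Y\<close> is a weak kernel of \<open>g : Y \<rightarrow> Z\<close>, respectively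
  \<open>g : Y \<rightarrow> Z\<close> is a weak cokernel of \<open>f : X \<rightarrow> Y\<close>.\<close>

definition is_weak_kernel ::
  "('o, 'm, 'r, 'z) linear_category_scheme \<Rightarrow> 'o \<Rightarrow> 'o \<Rightarrow> 'o \<Rightarrow> 'm \<Rightarrow> 'm \<Rightarrow> bool"
  where "is_weak_kernel D X Y Z f g \<longleftrightarrow>
    f \<in> Mor D X Y \<and>
    (\<forall>W\<in>Obj D. (\<lambda>h. Cmp D W X Y f h) ` Mor D W X
      = a_kernel (HomMod D W Y) (HomMod D W Z) (\<lambda>h. Cmp D W Y Z g h))"

definition is_weak_cokernel ::
  "('o, 'm, 'r, 'z) linear_category_scheme \<Rightarrow> 'o \<Rightarrow> 'o \<Rightarrow> 'o \<Rightarrow> 'm \<Rightarrow> 'm \<Rightarrow> bool"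
  where "is_weak_cokernel D X Y Z f g \<longleftrightarrow>
    g \<in> Mor D Y Z \<and>
    (\<forall>W\<in>Obj D. (\<lambda>h. Cmp D Y Z W h g) ` Mor D Z W
      = a_kernel (HomMod D Y W) (HomMod D X W) (\<lambda>h. Cmp D X Y W h f))"

definition has_weak_kernels :: "('o, 'm, 'r, 'z) linear_category_scheme \<Rightarrow> bool"
  where "has_weak_kernels D \<longleftrightarrow>
    (\<forall>Y\<in>Obj D. \<forall>Z\<in>Obj D. \<forall>g\<in>Mor D Y Z. \<exists>X\<in>Obj D. \<exists>f. is_weak_kernel D X Y Z f g)"

definition has_weak_cokernels :: "('o, 'm, 'r, 'z) linear_category_scheme \<Rightarrow> bool"
  where "has_weak_cokernels D \<longleftrightarrow>
    (\<forall>X\<in>Obj D. \<forall>Y\<in>Obj D. \<forall>f\<in>Mor D X Y. \<exists>Z\<in>Obj D. \<exists>g. is_weak_cokernel D X Y Z f g)"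

definition closed_under_weak_cokernels ::
  "('o, 'm, 'r, 'z) linear_category_scheme \<Rightarrow> 'o set \<Rightarrow> bool"
  where "closed_under_weak_cokernels D S \<longleftrightarrow>
    (\<forall>X\<in>S. \<forall>Y\<in>S. \<forall>f\<in>Mor D X Y. \<exists>Z\<in>S. \<exists>g. is_weak_cokernel D X Y Z f g)"

definition is_direct_summand :: "('o, 'm, 'r, 'z) linear_category_scheme \<Rightarrow> 'o \<Rightarrow> 'o \<Rightarrow> bool"
  where "is_direct_summand D X B \<longleftrightarrow> (\<exists>Y. is_biproduct D X Y B)"

definition closed_under_direct_summands ::
  "('o, 'm, 'r, 'z) linear_category_scheme \<Rightarrow> 'o set \<Rightarrow> bool"
  where "closed_under_direct_summands D S \<longleftrightarrow> (\<forall>B\<in>S. \<forall>X. is_direct_summand D X B \<longrightarrow> X \<in> S)"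

end

theory Submission imports Defs begin

text \<open>A full subcategory is coreflective as soon as every object \<open>Y\<close> admits a terminal map from
  it, that is a map \<open>\<epsilon> : E \<rightarrow> Y\<close> with \<open>E\<close> in \<open>S\<close> through which every map \<open>X \<rightarrow> Y\<close> with \<open>X\<close> in \<open>S\<close>
  factors uniquely. A precover \<open>p : A \<rightarrow> Y\<close> provides factorizations but not their uniqueness;
  the point is to cut \<open>A\<close> down to a direct summand on which \<open>p\<close> becomes injective on maps from \<open>S\<close>.

  Covering a weak kernel of \<open>p\<close> by an object of \<open>S\<close> yields \<open>f : B \<rightarrow> A\<close> in \<open>S\<close> with \<open>p f = 0\<close>,
  through which every map \<open>x : X \<rightarrow> A\<close> with \<open>X\<close> in \<open>S\<close> and \<open>p x = 0\<close> factors
  (\<open>precover_presentation\<close>). Let \<open>g : A \<rightarrow> C\<close> be a weak cokernel of \<open>f\<close> with \<open>C\<close> in \<open>S\<close>. Since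
  \<open>p f = 0\<close>, there is \<open>p'\<close> with \<open>p = p' g\<close>, and since \<open>p\<close> is a precover, there is \<open>h : C \<rightarrow> A\<close>
  with \<open>p' = p h\<close>. Hence \<open>p (1 - h g) = 0\<close>, so \<open>1 - h g\<close> factors through \<open>f\<close> and is killed by \<open>g\<close>.
  Thus \<open>g h g = g\<close>, and \<open>e = h g\<close> is an idempotent with \<open>p e = p\<close> and \<open>e f = 0\<close>
  (\<open>precover_idempotent\<close>): it keeps all of \<open>p\<close> and kills precisely the ambiguity of
  factorizations through \<open>p\<close>. The restriction of \<open>p\<close> to the image of \<open>e\<close> is the desired terminal
  map (\<open>exists_coreflection_map\<close>).\<close>

section \<open>Terminal maps from a full subcategory and coreflectivity\<close>

definition is_coreflection_map ::
  "('o, 'm, 'z) category_scheme \<Rightarrow> 'o set \<Rightarrow> 'o \<Rightarrow> 'o \<Rightarrow> 'm \<Rightarrow> bool"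
  where "is_coreflection_map D S E Y \<epsilon> \<longleftrightarrow>
    E \<in> S \<and> \<epsilon> \<in> Mor D E Y \<and>
    (\<forall>X\<in>S. \<forall>t\<in>Mor D X Y. \<exists>!k. k \<in> Mor D X E \<and> Cmp D X E Y \<epsilon> k = t)"

lemma full_subcategory_simps [simp]:
  "Obj (full_subcategory D S) = S"
  "Mor (full_subcategory D S) = Mor D"
  "Cmp (full_subcategory D S) = Cmp D"
  "Idn (full_subcategory D S) = Idn D"
  by (simp_all add: full_subcategory_def)

lemma inclusion_functor_simps [simp]:
  "FObj inclusion_functor X = X"
  "FMor inclusion_functor X Y f = f"
  by (simp_all add: inclusion_functor_def)

context category
begin

lemma category_full_subcategory:
  assumes "S \<subseteq> Obj C"
  shows "category (full_subcategory C S)"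
  using assms
  by unfold_locales
    (auto simp: subset_iff Idn_closed Cmp_closed Cmp_Idn_left Cmp_Idn_right Cmp_assoc)

lemma cfunctor_inclusion:
  assumes "S \<subseteq> Obj C"
  shows "cfunctor (full_subcategory C S) C inclusion_functor"
proof -
  interpret S: category "full_subcategory C S"
    by (rule category_full_subcategory[OF assms])
  show ?thesis
    using assms by unfold_locales auto
qed

text \<open>The coreflection maps are the counit. The right adjoint sends \<open>v : Y \<rightarrow> Y'\<close> to the unique
  lift of \<open>v \<circ> \<epsilon> Y\<close> along \<open>\<epsilon> Y'\<close>, and the bijection of the adjunction sends a map to its
  lift. Functoriality and naturality hold because both sides are lifts of the same map.\<close>

lemma coreflectiveI:
  assumes S: "S \<subseteq> Obj C"
    and ex: "\<And>Y. Y \<in> Obj C \<Longrightarrow> \<exists>E \<epsilon>. is_coreflection_map C S E Y \<epsilon>"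
  shows "coreflective C S"
proof -
  obtain E \<epsilon> where "\<And>Y. Y \<in> Obj C \<Longrightarrow> is_coreflection_map C S (E Y) Y (\<epsilon> Y)"
    using ex by metis
  then have E: "\<And>Y. Y \<in> Obj C \<Longrightarrow> E Y \<in> S"
    and \<epsilon>: "\<And>Y. Y \<in> Obj C \<Longrightarrow> \<epsilon> Y \<in> Mor C (E Y) Y"
    and univ: "\<And>X Y t. \<lbrakk>Y \<in> Obj C; X \<in> S; t \<in> Mor C X Y\<rbrakk>
        \<Longrightarrow> \<exists>!k. k \<in> Mor C X (E Y) \<and> Cmp C X (E Y) Y (\<epsilon> Y) k = t"
    by (auto simp: is_coreflection_map_def)
  have SO: "\<And>X. X \<in> S \<Longrightarrow> X \<in> Obj C"
    using S by auto
  note EO = SO[OF E]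
  define lift where
    "lift X Y t = (THE k. k \<in> Mor C X (E Y) \<and> Cmp C X (E Y) Y (\<epsilon> Y) k = t)" for X Y t
  have lift: "lift X Y t \<in> Mor C X (E Y)" "Cmp C X (E Y) Y (\<epsilon> Y) (lift X Y t) = t"
    if "Y \<in> Obj C" "X \<in> S" "t \<in> Mor C X Y" for X Y t
    using theI'[OF univ[OF that]] by (simp_all add: lift_def)
  have lift_eqI: "lift X Y t = k"
    if "Y \<in> Obj C" "X \<in> S" "k \<in> Mor C X (E Y)" "Cmp C X (E Y) Y (\<epsilon> Y) k = t" for X Y t k
  proof -
    have "t \<in> Mor C X Y"
      using Cmp_closed[OF SO EO, OF that(2) that(1) that(1) that(3) \<epsilon>] that by simp
    then show ?thesis
      using univ[OF that(1,2)] lift[OF that(1,2)] that(3,4) by metis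
  qed
  define G where "G = \<lparr>FObj = E, FMor = (\<lambda>Y Y' v. lift (E Y) Y' (Cmp C (E Y) Y Y' v (\<epsilon> Y)))\<rparr>"
  have G [simp]: "FObj G = E"
    "FMor G Y Y' v = lift (E Y) Y' (Cmp C (E Y) Y Y' v (\<epsilon> Y))" for Y Y' v
    by (simp_all add: G_def)
  have ve: "Cmp C (E Y) Y Y' v (\<epsilon> Y) \<in> Mor C (E Y) Y'"
    if "Y \<in> Obj C" "Y' \<in> Obj C" "v \<in> Mor C Y Y'" for Y Y' v
    using that by (intro Cmp_closed EO \<epsilon>) auto
  note Gv = lift[OF _ E ve]
  have "cfunctor C (full_subcategory C S) G"
  proof (intro cfunctor.intro cfunctor_axioms.intro category_axioms category_full_subcategory[OF S])
    fix Y assume Y: "Y \<in> Obj C"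
    show "FObj G Y \<in> Obj (full_subcategory C S)"
      using E[OF Y] by simp
    show "FMor G Y Y (Idn C Y) = Idn (full_subcategory C S) (FObj G Y)"
      using Y by (auto intro!: lift_eqI simp: E EO \<epsilon> Idn_closed Cmp_Idn_left Cmp_Idn_right)
  next
    fix Y Y' v assume Y: "Y \<in> Obj C" "Y' \<in> Obj C" "v \<in> Mor C Y Y'"
    show "FMor G Y Y' v \<in> Mor (full_subcategory C S) (FObj G Y) (FObj G Y')"
      using Gv[OF Y(2) Y(1) Y(1) Y(2) Y(3)] by simp
  next
    fix X Y Z f g
    assume X: "X \<in> Obj C" and Y: "Y \<in> Obj C" and Z: "Z \<in> Obj C"
      and f: "f \<in> Mor C X Y" and g: "g \<in> Mor C Y Z"
    let ?f = "FMor G X Y f" and ?g = "FMor G Y Z g"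
    have f': "?f \<in> Mor C (E X) (E Y)" "Cmp C (E X) (E Y) Y (\<epsilon> Y) ?f = Cmp C (E X) X Y f (\<epsilon> X)"
      using Gv[OF Y X X Y f] by simp_all
    have g': "?g \<in> Mor C (E Y) (E Z)" "Cmp C (E Y) (E Z) Z (\<epsilon> Z) ?g = Cmp C (E Y) Y Z g (\<epsilon> Y)"
      using Gv[OF Z Y Y Z g] by simp_all
    have "Cmp C (E X) (E Z) Z (\<epsilon> Z) (Cmp C (E X) (E Y) (E Z) ?g ?f)
        = Cmp C (E X) (E Y) Z (Cmp C (E Y) Y Z g (\<epsilon> Y)) ?f"
      using Cmp_assoc[OF EO EO EO Z f'(1) g'(1) \<epsilon>] X Y Z g'(2) by simp
    also have "\<dots> = Cmp C (E X) X Z (Cmp C X Y Z g f) (\<epsilon> X)"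
      using Cmp_assoc[OF EO EO Y Z f'(1) \<epsilon> g] Cmp_assoc[OF EO X Y Z \<epsilon> f g] X Y f'(2) by simp
    finally show "FMor G X Z (Cmp C X Y Z g f)
        = Cmp (full_subcategory C S) (FObj G X) (FObj G Y) (FObj G Z) ?g ?f"
      using X Y Z Cmp_closed[OF EO EO EO f'(1) g'(1)] by (auto intro!: lift_eqI E)
  qed
  moreover have "bij_betw (lift X Y) (Mor C X Y) (Mor C X (E Y))" if "X \<in> S" "Y \<in> Obj C" for X Y
    using that lift lift_eqI Cmp_closed[OF SO EO _ _ \<epsilon>]
    by (intro bij_betw_byWitness[where f' = "Cmp C X (E Y) Y (\<epsilon> Y)"]) auto
  moreover have "lift X' Y (Cmp C X' X Y h u) = Cmp C X' X (E Y) (lift X Y h) u"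
    if "X' \<in> S" "X \<in> S" "Y \<in> Obj C" "u \<in> Mor C X' X" "h \<in> Mor C X Y" for X' X Y u h
  proof -
    let ?h = "lift X Y h"
    have h': "?h \<in> Mor C X (E Y)" "Cmp C X (E Y) Y (\<epsilon> Y) ?h = h"
      using lift that by simp_all
    have "Cmp C X' (E Y) Y (\<epsilon> Y) (Cmp C X' X (E Y) ?h u) = Cmp C X' X Y h u"
      using Cmp_assoc[OF SO SO EO _ _ h'(1) \<epsilon>] that h'(2) by simp
    then show ?thesis
      using that Cmp_closed[OF SO SO EO _ h'(1)] by (auto intro!: lift_eqI)
  qed
  moreover have "lift X Y' (Cmp C X Y Y' v h)
      = Cmp C X (E Y) (E Y') (lift (E Y) Y' (Cmp C (E Y) Y Y' v (\<epsilon> Y))) (lift X Y h)"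
    if "X \<in> S" "Y \<in> Obj C" "Y' \<in> Obj C" "h \<in> Mor C X Y" "v \<in> Mor C Y Y'" for X Y Y' h v
  proof -
    let ?v = "lift (E Y) Y' (Cmp C (E Y) Y Y' v (\<epsilon> Y))" and ?h = "lift X Y h"
    have v': "?v \<in> Mor C (E Y) (E Y')" "Cmp C (E Y) (E Y') Y' (\<epsilon> Y') ?v = Cmp C (E Y) Y Y' v (\<epsilon> Y)"
      using Gv that by simp_all
    have h': "?h \<in> Mor C X (E Y)" "Cmp C X (E Y) Y (\<epsilon> Y) ?h = h"
      using lift that by simp_all
    have "Cmp C X (E Y') Y' (\<epsilon> Y') (Cmp C X (E Y) (E Y') ?v ?h)
        = Cmp C X (E Y) Y' (Cmp C (E Y) Y Y' v (\<epsilon> Y)) ?h"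
      using Cmp_assoc[OF SO EO EO _ h'(1) v'(1) \<epsilon>] that v'(2) by simp
    also have "\<dots> = Cmp C X Y Y' v h"
      using Cmp_assoc[OF SO EO _ _ h'(1) \<epsilon>] that h'(2) by simp
    finally show ?thesis
      using that Cmp_closed[OF SO EO EO h'(1) v'(1)] by (auto intro!: lift_eqI)
  qed
  ultimately have "adjunction (full_subcategory C S) C inclusion_functor G lift"
    by (intro adjunction.intro adjunction_axioms.intro cfunctor_inclusion[OF S]) auto
  then show ?thesis
    unfolding coreflective_def has_right_adjoint_def by blast
qed

end

section \<open>Subtraction of maps in a linear category\<close>

context linear_category
begin

lemma abelian_group_HomMod:
  "\<lbrakk>X \<in> Obj D; Y \<in> Obj D\<rbrakk> \<Longrightarrow> abelian_group (HomMod D X Y)"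
  using HomMod_module by (simp add: Module.module_def)

lemma zero_in_Mor: "\<lbrakk>X \<in> Obj D; Y \<in> Obj D\<rbrakk> \<Longrightarrow> \<zero>\<^bsub>HomMod D X Y\<^esub> \<in> Mor D X Y"
  using abelian_group_HomMod carrier_HomMod
  by (metis abelian_group.axioms(1) abelian_monoid.zero_closed)

lemma minus_in_Mor:
  "\<lbrakk>X \<in> Obj D; Y \<in> Obj D; f \<in> Mor D X Y; g \<in> Mor D X Y\<rbrakk> \<Longrightarrow> f \<ominus>\<^bsub>HomMod D X Y\<^esub> g \<in> Mor D X Y"
  using abelian_group_HomMod carrier_HomMod by (metis abelian_group.minus_closed)

lemma minus_eq_iff_eq_add:
  assumes "X \<in> Obj D" "Y \<in> Obj D" "f \<in> Mor D X Y" "g \<in> Mor D X Y" "h \<in> Mor D X Y"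
  shows "f \<ominus>\<^bsub>HomMod D X Y\<^esub> g = h \<longleftrightarrow> f = h \<oplus>\<^bsub>HomMod D X Y\<^esub> g"
proof -
  interpret H: abelian_group "HomMod D X Y"
    using assms by (intro abelian_group_HomMod)
  have "f \<in> carrier (HomMod D X Y)" "g \<in> carrier (HomMod D X Y)" "h \<in> carrier (HomMod D X Y)"
    using assms carrier_HomMod by auto
  then show ?thesis
    by (metis H.a_assoc H.a_inv_closed H.l_neg H.r_neg H.minus_eq H.r_zero)
qed

lemma minus_eq_zero_iff:
  assumes "X \<in> Obj D" "Y \<in> Obj D" "f \<in> Mor D X Y" "g \<in> Mor D X Y"
  shows "f \<ominus>\<^bsub>HomMod D X Y\<^esub> g = \<zero>\<^bsub>HomMod D X Y\<^esub> \<longleftrightarrow> f = g"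
proof -
  interpret H: abelian_group "HomMod D X Y"
    using assms by (intro abelian_group_HomMod)
  show ?thesis
    using assms by (simp add: minus_eq_iff_eq_add zero_in_Mor carrier_HomMod)
qed

lemma Cmp_minus_right:
  assumes "X \<in> Obj D" "Y \<in> Obj D" "Z \<in> Obj D" "f \<in> Mor D X Y" "g \<in> Mor D X Y" "h \<in> Mor D Y Z"
  shows "Cmp D X Y Z h (f \<ominus>\<^bsub>HomMod D X Y\<^esub> g)
    = Cmp D X Y Z h f \<ominus>\<^bsub>HomMod D X Z\<^esub> Cmp D X Y Z h g"
proof -
  let ?d = "f \<ominus>\<^bsub>HomMod D X Y\<^esub> g"
  have d: "?d \<in> Mor D X Y" "f = ?d \<oplus>\<^bsub>HomMod D X Y\<^esub> g"
    using assms minus_eq_iff_eq_add minus_in_Mor by blast+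
  then have "Cmp D X Y Z h f = Cmp D X Y Z h ?d \<oplus>\<^bsub>HomMod D X Z\<^esub> Cmp D X Y Z h g"
    using Cmp_add_right assms by metis
  then show ?thesis
    using minus_eq_iff_eq_add[of X Z "Cmp D X Y Z h f" "Cmp D X Y Z h g"] assms d Cmp_closed
    by metis
qed

lemma Cmp_minus_left:
  assumes "X \<in> Obj D" "Y \<in> Obj D" "Z \<in> Obj D" "f \<in> Mor D X Y" "g \<in> Mor D Y Z" "h \<in> Mor D Y Z"
  shows "Cmp D X Y Z (g \<ominus>\<^bsub>HomMod D Y Z\<^esub> h) f
    = Cmp D X Y Z g f \<ominus>\<^bsub>HomMod D X Z\<^esub> Cmp D X Y Z h f"
proof -
  let ?d = "g \<ominus>\<^bsub>HomMod D Y Z\<^esub> h"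
  have d: "?d \<in> Mor D Y Z" "g = ?d \<oplus>\<^bsub>HomMod D Y Z\<^esub> h"
    using assms minus_eq_iff_eq_add minus_in_Mor by blast+
  then have "Cmp D X Y Z g f = Cmp D X Y Z ?d f \<oplus>\<^bsub>HomMod D X Z\<^esub> Cmp D X Y Z h f"
    using Cmp_add_left assms by metis
  then show ?thesis
    using minus_eq_iff_eq_add[of X Z "Cmp D X Y Z g f" "Cmp D X Y Z h f"] assms d Cmp_closed
    by metis
qed

lemma Cmp_zero_right:
  assumes "X \<in> Obj D" "Y \<in> Obj D" "Z \<in> Obj D" "h \<in> Mor D Y Z"
  shows "Cmp D X Y Z h \<zero>\<^bsub>HomMod D X Y\<^esub> = \<zero>\<^bsub>HomMod D X Z\<^esub>"
  using Cmp_minus_right[of X Y Z "\<zero>\<^bsub>HomMod D X Y\<^esub>" "\<zero>\<^bsub>HomMod D X Y\<^esub>" h] assms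
    minus_eq_zero_iff zero_in_Mor Cmp_closed by metis

lemma Cmp_zero_left:
  assumes "X \<in> Obj D" "Y \<in> Obj D" "Z \<in> Obj D" "f \<in> Mor D X Y"
  shows "Cmp D X Y Z \<zero>\<^bsub>HomMod D Y Z\<^esub> f = \<zero>\<^bsub>HomMod D X Z\<^esub>"
  using Cmp_minus_left[of X Y Z f "\<zero>\<^bsub>HomMod D Y Z\<^esub>" "\<zero>\<^bsub>HomMod D Y Z\<^esub>"] assms
    minus_eq_zero_iff zero_in_Mor Cmp_closed by metis

section \<open>Split idempotents and weak (co)kernels\<close>

text \<open>The complement of \<open>E\<close> is obtained by splitting the idempotent \<open>1 - s r\<close>.\<close>

lemma retract_is_direct_summand:
  assumes "karoubian D" and E: "E \<in> Obj D" and A: "A \<in> Obj D"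
    and r: "r \<in> Mor D A E" and s: "s \<in> Mor D E A" and rs: "Cmp D E A E r s = Idn D E"
  shows "is_direct_summand D E A"
proof -
  define e where "e = Cmp D A E A s r"
  define c where "c = Idn D A \<ominus>\<^bsub>HomMod D A A\<^esub> e"
  have e: "e \<in> Mor D A A"
    using e_def Cmp_closed A E r s by simp
  have c: "c \<in> Mor D A A"
    using c_def minus_in_Mor Idn_closed A e by simp
  have rc: "Cmp D A A E r c = \<zero>\<^bsub>HomMod D A E\<^esub>"
  proof -
    have "Cmp D A A E r e = r"
      using Cmp_assoc[OF A E A E r s r] rs Cmp_Idn_left[OF A E r] by (simp add: e_def)
    then show ?thesis
      using A E r e minus_eq_zero_iff
      by (simp add: c_def Cmp_minus_right Idn_closed Cmp_Idn_right)
  qed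
  have cs: "Cmp D E A A c s = \<zero>\<^bsub>HomMod D E A\<^esub>"
  proof -
    have "Cmp D E A A e s = s"
      using Cmp_assoc[OF E A E A s r s] rs Cmp_Idn_right[OF E A s] by (simp add: e_def)
    then show ?thesis
      using A E s e minus_eq_zero_iff
      by (simp add: c_def Cmp_minus_left Idn_closed Cmp_Idn_left)
  qed
  have "Cmp D A A A c e = \<zero>\<^bsub>HomMod D A A\<^esub>"
    using Cmp_assoc[OF A E A A r s c] cs Cmp_zero_left[OF A E A r] by (simp add: e_def)
  then have "Cmp D A A A c c = c \<ominus>\<^bsub>HomMod D A A\<^esub> \<zero>\<^bsub>HomMod D A A\<^esub>"
    using Cmp_minus_right[OF A A A Idn_closed[OF A] e c] Cmp_Idn_right[OF A A c]
    by (simp flip: c_def)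
  also have "\<dots> = c"
  proof -
    interpret H: abelian_group "HomMod D A A"
      using A by (intro abelian_group_HomMod)
    show ?thesis
      using c A by (simp add: minus_eq_iff_eq_add zero_in_Mor carrier_HomMod)
  qed
  finally obtain F r' s' where F: "F \<in> Obj D" and r': "r' \<in> Mor D A F" and s': "s' \<in> Mor D F A"
    and sr': "Cmp D A F A s' r' = c" and rs': "Cmp D F A F r' s' = Idn D F"
    using assms(1) A c unfolding karoubian_def splits_def by blast
  have "Cmp D F A A c s' = s'"
    using Cmp_assoc[OF F A F A s' r' s'] rs' sr' Cmp_Idn_right[OF F A s'] by simp
  then have rs'0: "Cmp D F A E r s' = \<zero>\<^bsub>HomMod D F E\<^esub>"
    using Cmp_assoc[OF F A A E s' c r] rc Cmp_zero_left[OF F A E s'] by simp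
  have "Cmp D A A F r' c = r'"
    using Cmp_assoc[OF A F A F r' s' r'] rs' sr' Cmp_Idn_left[OF A F r'] by simp
  then have r's0: "Cmp D E A F r' s = \<zero>\<^bsub>HomMod D E F\<^esub>"
    using Cmp_assoc[OF E A A F s c r'] cs Cmp_zero_right[OF E A F r'] by simp
  have "e \<oplus>\<^bsub>HomMod D A A\<^esub> c = Idn D A"
  proof -
    interpret H: abelian_group "HomMod D A A"
      using A by (intro abelian_group_HomMod)
    have "Idn D A = c \<oplus>\<^bsub>HomMod D A A\<^esub> e"
      using minus_eq_iff_eq_add[OF A A Idn_closed[OF A] e c] by (simp add: c_def)
    then show ?thesis
      using H.a_comm c e carrier_HomMod[OF A A] by simp
  qed
  then have "is_biproduct D E F A"
    unfolding is_biproduct_def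
    using E F A r s r' s' rs rs' rs'0 r's0 sr' unfolding e_def by blast
  then show ?thesis
    unfolding is_direct_summand_def by blast
qed

lemma weak_kernel_Cmp_zero:
  assumes "X \<in> Obj D" "Y \<in> Obj D" "is_weak_kernel D X Y Z f g"
  shows "Cmp D X Y Z g f = \<zero>\<^bsub>HomMod D X Z\<^esub>"
proof -
  have "Cmp D X X Y f (Idn D X) \<in> a_kernel (HomMod D X Y) (HomMod D X Z) (Cmp D X Y Z g)"
    using assms Idn_closed unfolding is_weak_kernel_def by blast
  then show ?thesis
    using assms by (auto simp: a_kernel_def' is_weak_kernel_def Cmp_Idn_right)
qed

lemma weak_kernel_factor:
  assumes "is_weak_kernel D X Y Z f g" "W \<in> Obj D" "Y \<in> Obj D" "h \<in> Mor D W Y"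
    and "Cmp D W Y Z g h = \<zero>\<^bsub>HomMod D W Z\<^esub>"
  obtains k where "k \<in> Mor D W X" "h = Cmp D W X Y f k"
proof -
  have "h \<in> a_kernel (HomMod D W Y) (HomMod D W Z) (Cmp D W Y Z g)"
    using assms by (simp add: a_kernel_def' carrier_HomMod)
  then show ?thesis
    using assms that unfolding is_weak_kernel_def by blast
qed

lemma weak_cokernel_Cmp_zero:
  assumes "Y \<in> Obj D" "Z \<in> Obj D" "is_weak_cokernel D X Y Z f g"
  shows "Cmp D X Y Z g f = \<zero>\<^bsub>HomMod D X Z\<^esub>"
proof -
  have "Cmp D Y Z Z (Idn D Z) g
      \<in> a_kernel (HomMod D Y Z) (HomMod D X Z) (\<lambda>h. Cmp D X Y Z h f)"
    using assms Idn_closed unfolding is_weak_cokernel_def by blast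
  then show ?thesis
    using assms by (auto simp: a_kernel_def' is_weak_cokernel_def Cmp_Idn_left)
qed

lemma weak_cokernel_factor:
  assumes "is_weak_cokernel D X Y Z f g" "W \<in> Obj D" "Y \<in> Obj D" "h \<in> Mor D Y W"
    and "Cmp D X Y W h f = \<zero>\<^bsub>HomMod D X W\<^esub>"
  obtains k where "k \<in> Mor D Z W" "h = Cmp D Y Z W k g"
proof -
  have "h \<in> a_kernel (HomMod D Y W) (HomMod D X W) (\<lambda>h. Cmp D X Y W h f)"
    using assms by (simp add: a_kernel_def' carrier_HomMod)
  then show ?thesis
    using assms that unfolding is_weak_cokernel_def by blast
qed

section \<open>From precovers to coreflection maps\<close>

lemma precover_factor:
  assumes "is_precover D S A Y p" "X \<in> S" "t \<in> Mor D X Y"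
  obtains k where "k \<in> Mor D X A" "t = Cmp D X A Y p k"
  using assms unfolding is_precover_def by blast

text \<open>A weak kernel of \<open>p\<close> need not lie in \<open>S\<close>, but an object \<open>B\<close> of \<open>S\<close> that precovers it
  has enough maps from \<open>S\<close> to replace it. Thus \<open>D(-,B) \<rightarrow> D(-,A) \<rightarrow> D(-,Y) \<rightarrow> 0\<close> is exact on \<open>S\<close>,
  and the failure of uniqueness of lifts along \<open>p\<close> is described by a map in \<open>S\<close>.\<close>

lemma precover_presentation:
  assumes S: "S \<subseteq> Obj D" and "precovering D S" "has_weak_kernels D"
    and Y: "Y \<in> Obj D" and p: "is_precover D S A Y p"
  obtains B f where "B \<in> S" "f \<in> Mor D B A" "Cmp D B A Y p f = \<zero>\<^bsub>HomMod D B Y\<^esub>"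
    and "\<And>X x. \<lbrakk>X \<in> S; x \<in> Mor D X A; Cmp D X A Y p x = \<zero>\<^bsub>HomMod D X Y\<^esub>\<rbrakk>
      \<Longrightarrow> \<exists>u\<in>Mor D X B. x = Cmp D X B A f u"
proof -
  have A: "A \<in> Obj D" and pm: "p \<in> Mor D A Y"
    using p S by (auto simp: is_precover_def)
  obtain K k where K: "K \<in> Obj D" and k: "is_weak_kernel D K A Y k p"
    using assms(3) A Y pm unfolding has_weak_kernels_def by blast
  obtain B q where q: "is_precover D S B K q"
    using assms(2) K unfolding precovering_def by blast
  have km: "k \<in> Mor D K A"
    using k by (simp add: is_weak_kernel_def)
  have BS: "B \<in> S" and B: "B \<in> Obj D" and qm: "q \<in> Mor D B K"
    using q S by (auto simp: is_precover_def)
  show ?thesis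
  proof (rule that[of B "Cmp D B K A k q"])
    show "B \<in> S" by fact
    show "Cmp D B K A k q \<in> Mor D B A"
      by (rule Cmp_closed[OF B K A qm km])
    show "Cmp D B A Y p (Cmp D B K A k q) = \<zero>\<^bsub>HomMod D B Y\<^esub>"
      using Cmp_assoc[OF B K A Y qm km pm] weak_kernel_Cmp_zero[OF K A k]
        Cmp_zero_left[OF B K Y qm] by simp
  next
    fix X x assume XS: "X \<in> S" and x: "x \<in> Mor D X A"
      and px: "Cmp D X A Y p x = \<zero>\<^bsub>HomMod D X Y\<^esub>"
    have X: "X \<in> Obj D"
      using XS S by auto
    obtain y where y: "y \<in> Mor D X K" "x = Cmp D X K A k y"
      using weak_kernel_factor[OF k X A x px] .
    obtain u where u: "u \<in> Mor D X B" "y = Cmp D X B K q u"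
      using precover_factor[OF q XS y(1)] .
    show "\<exists>u\<in>Mor D X B. x = Cmp D X B A (Cmp D B K A k q) u"
      using Cmp_assoc[OF X B K A u(1) qm km] u y(2) by metis
  qed
qed

text \<open>By the last property, \<open>e x\<close> depends only on \<open>p x\<close> for a map \<open>x\<close> from \<open>S\<close>; it holds
  because \<open>e = h g\<close> for a weak cokernel \<open>g\<close> of the map \<open>f\<close> in the presentation of \<open>p\<close>.\<close>

lemma precover_idempotent:
  assumes S: "S \<subseteq> Obj D" and "precovering D S" "has_weak_kernels D"
    and "closed_under_weak_cokernels D S"
    and Y: "Y \<in> Obj D" and p: "is_precover D S A Y p"
  obtains e where "e \<in> Mor D A A" "Cmp D A A A e e = e" "Cmp D A A Y p e = p"
    and "\<And>X x. \<lbrakk>X \<in> S; x \<in> Mor D X A; Cmp D X A Y p x = \<zero>\<^bsub>HomMod D X Y\<^esub>\<rbrakk>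
      \<Longrightarrow> Cmp D X A A e x = \<zero>\<^bsub>HomMod D X A\<^esub>"
proof -
  have AS: "A \<in> S" and A: "A \<in> Obj D" and pm: "p \<in> Mor D A Y"
    using p S by (auto simp: is_precover_def)
  obtain B f where BS: "B \<in> S" and f: "f \<in> Mor D B A" and pf: "Cmp D B A Y p f = \<zero>\<^bsub>HomMod D B Y\<^esub>"
    and exact: "\<And>X x. \<lbrakk>X \<in> S; x \<in> Mor D X A; Cmp D X A Y p x = \<zero>\<^bsub>HomMod D X Y\<^esub>\<rbrakk>
      \<Longrightarrow> \<exists>u\<in>Mor D X B. x = Cmp D X B A f u"
    using precover_presentation[OF S assms(2,3) Y p] by metis
  obtain C g where CS: "C \<in> S" and g: "is_weak_cokernel D B A C f g"
    using assms(4) AS BS f unfolding closed_under_weak_cokernels_def by blast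
  have B: "B \<in> Obj D" and C: "C \<in> Obj D" and gm: "g \<in> Mor D A C"
    using BS CS S g by (auto simp: is_weak_cokernel_def)
  obtain p' where p': "p' \<in> Mor D C Y" "p = Cmp D A C Y p' g"
    using weak_cokernel_factor[OF g Y A pm pf] .
  obtain h where h: "h \<in> Mor D C A" "p' = Cmp D C A Y p h"
    using precover_factor[OF p CS p'(1)] .
  define e where "e = Cmp D A C A h g"
  have e: "e \<in> Mor D A A"
    using Cmp_closed[OF A C A gm h(1)] by (simp add: e_def)
  have pe: "Cmp D A A Y p e = p"
    using Cmp_assoc[OF A C A Y gm h(1) pm] h(2)[symmetric] p'(2)[symmetric] by (simp add: e_def)
  have gx: "Cmp D X A C g x = \<zero>\<^bsub>HomMod D X C\<^esub>"
    if XS: "X \<in> S" and x: "x \<in> Mor D X A" and px: "Cmp D X A Y p x = \<zero>\<^bsub>HomMod D X Y\<^esub>" for X x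
  proof -
    have X: "X \<in> Obj D"
      using XS S by auto
    obtain u where u: "u \<in> Mor D X B" "x = Cmp D X B A f u"
      using exact[OF XS x px] by blast
    show ?thesis
      using Cmp_assoc[OF X B A C u(1) f gm] u(2) weak_cokernel_Cmp_zero[OF A C g]
        Cmp_zero_left[OF X B C u(1)] by simp
  qed
  let ?c = "Idn D A \<ominus>\<^bsub>HomMod D A A\<^esub> e"
  have "Cmp D A A Y p ?c = \<zero>\<^bsub>HomMod D A Y\<^esub>"
    using A Y pm e pe minus_eq_zero_iff[OF A Y pm pm]
    by (simp add: Cmp_minus_right Idn_closed Cmp_Idn_right)
  then have "Cmp D A A C g ?c = \<zero>\<^bsub>HomMod D A C\<^esub>"
    using gx[OF AS] minus_in_Mor[OF A A Idn_closed[OF A] e] by simp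
  then have ge: "Cmp D A A C g e = g"
    using A C gm e Cmp_closed[OF A A C e gm] minus_eq_zero_iff
    by (simp add: Cmp_minus_right Idn_closed Cmp_Idn_right)
  show ?thesis
  proof (rule that[OF e _ pe])
    show "Cmp D A A A e e = e"
      using Cmp_assoc[OF A A C A e gm h(1)] ge by (simp add: e_def)
  next
    fix X x assume X: "X \<in> S" "x \<in> Mor D X A" "Cmp D X A Y p x = \<zero>\<^bsub>HomMod D X Y\<^esub>"
    then have XO: "X \<in> Obj D"
      using S by auto
    show "Cmp D X A A e x = \<zero>\<^bsub>HomMod D X A\<^esub>"
      using Cmp_assoc[OF XO A C A X(2) gm h(1)] gx[OF X] Cmp_zero_right[OF XO C A h(1)]
      by (simp add: e_def)
  qed
qed

text \<open>Splitting \<open>e\<close> as \<open>s r\<close>, the coreflection map is \<open>p s\<close>: a lift \<open>k\<close> along \<open>p\<close> gives the lift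
  \<open>r k\<close> along \<open>p s\<close> as \<open>p e = p\<close>. The difference \<open>d\<close> of two lifts along \<open>p s\<close> has
  \<open>p s d = 0\<close>, hence \<open>e s d = 0\<close>, and applying \<open>r\<close>, which satisfies \<open>r e = r\<close>, gives \<open>d = r s d = 0\<close>.\<close>

lemma exists_coreflection_map:
  assumes S: "S \<subseteq> Obj D" and "precovering D S" "has_weak_kernels D"
    and "closed_under_weak_cokernels D S"
    and "karoubian D" "closed_under_direct_summands D S"
    and Y: "Y \<in> Obj D"
  shows "\<exists>E \<epsilon>. is_coreflection_map D S E Y \<epsilon>"
proof -
  obtain A p where p: "is_precover D S A Y p"
    using assms(2) Y unfolding precovering_def by blast
  have AS: "A \<in> S" and A: "A \<in> Obj D" and pm: "p \<in> Mor D A Y"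
    using p S by (auto simp: is_precover_def)
  obtain e where e: "e \<in> Mor D A A" "Cmp D A A A e e = e" "Cmp D A A Y p e = p"
    and kill: "\<And>X x. \<lbrakk>X \<in> S; x \<in> Mor D X A; Cmp D X A Y p x = \<zero>\<^bsub>HomMod D X Y\<^esub>\<rbrakk>
      \<Longrightarrow> Cmp D X A A e x = \<zero>\<^bsub>HomMod D X A\<^esub>"
    using precover_idempotent[OF S assms(2-4) Y p] by metis
  obtain E r s where E: "E \<in> Obj D" and r: "r \<in> Mor D A E" and s: "s \<in> Mor D E A"
    and sr: "Cmp D A E A s r = e" and rs: "Cmp D E A E r s = Idn D E"
    using assms(5) A e(1,2) unfolding karoubian_def splits_def by blast
  have ES: "E \<in> S"
    using retract_is_direct_summand[OF assms(5) E A r s rs] assms(6) AS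
    unfolding closed_under_direct_summands_def by blast
  let ?\<epsilon> = "Cmp D E A Y p s"
  have \<epsilon>: "?\<epsilon> \<in> Mor D E Y"
    by (rule Cmp_closed[OF E A Y s pm])
  have ex: "\<exists>k. k \<in> Mor D X E \<and> Cmp D X E Y ?\<epsilon> k = t" if XS: "X \<in> S" and t: "t \<in> Mor D X Y" for X t
  proof -
    have X: "X \<in> Obj D"
      using XS S by auto
    obtain k where k: "k \<in> Mor D X A" "t = Cmp D X A Y p k"
      using precover_factor[OF p XS t] .
    have rk: "Cmp D X A E r k \<in> Mor D X E"
      by (rule Cmp_closed[OF X A E k(1) r])
    have "Cmp D X E Y ?\<epsilon> (Cmp D X A E r k) = Cmp D X A Y p (Cmp D X A A e k)"
      using Cmp_assoc[OF X E A Y rk s pm] Cmp_assoc[OF X A E A k(1) r s] sr by simp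
    also have "\<dots> = t"
      using Cmp_assoc[OF X A A Y k(1) e(1) pm] e(3) k(2) by simp
    finally show ?thesis
      using rk by blast
  qed
  have eq: "k = k'"
    if XS: "X \<in> S" and k: "k \<in> Mor D X E" and k': "k' \<in> Mor D X E"
      and eqk: "Cmp D X E Y ?\<epsilon> k = Cmp D X E Y ?\<epsilon> k'" for X k k'
  proof -
    have X: "X \<in> Obj D"
      using XS S by auto
    let ?d = "k \<ominus>\<^bsub>HomMod D X E\<^esub> k'"
    have d: "?d \<in> Mor D X E"
      by (rule minus_in_Mor[OF X E k k'])
    have sd: "Cmp D X E A s ?d \<in> Mor D X A"
      by (rule Cmp_closed[OF X E A d s])
    have "Cmp D X E Y ?\<epsilon> ?d = \<zero>\<^bsub>HomMod D X Y\<^esub>"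
      using Cmp_minus_right[OF X E Y k k' \<epsilon>] eqk
        minus_eq_zero_iff[OF X Y Cmp_closed[OF X E Y k' \<epsilon>] Cmp_closed[OF X E Y k' \<epsilon>]] by simp
    then have "Cmp D X A Y p (Cmp D X E A s ?d) = \<zero>\<^bsub>HomMod D X Y\<^esub>"
      using Cmp_assoc[OF X E A Y d s pm] by simp
    then have esd: "Cmp D X A A e (Cmp D X E A s ?d) = \<zero>\<^bsub>HomMod D X A\<^esub>"
      by (rule kill[OF XS sd])
    have re: "Cmp D A A E r e = r"
      using Cmp_assoc[OF A E A E r s r] rs sr Cmp_Idn_left[OF A E r] by simp
    have "?d = Cmp D X A E r (Cmp D X E A s ?d)"
      using Cmp_assoc[OF X E A E d s r] rs Cmp_Idn_left[OF X E d] by simp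
    also have "\<dots> = Cmp D X A E r (Cmp D X A A e (Cmp D X E A s ?d))"
      using Cmp_assoc[OF X A A E sd e(1) r] re by simp
    also have "\<dots> = \<zero>\<^bsub>HomMod D X E\<^esub>"
      using esd Cmp_zero_right[OF X A E r] by simp
    finally show ?thesis
      using minus_eq_zero_iff[OF X E k k'] by simp
  qed
  have "is_coreflection_map D S E Y ?\<epsilon>"
    unfolding is_coreflection_map_def using ES \<epsilon> ex eq by metis
  then show ?thesis
    by blast
qed

end

section \<open>Coreflectivity\<close>

theorem corollary1p4:
  fixes R :: "('r, 'b) ring_scheme"
    and D :: "('o, 'm, 'r, 'z) linear_category_scheme"
    and S :: "'o set"
  assumes "cring R"
    and "additive_linear_category R D"
    and "karoubian D"
    and "has_weak_kernels D"
    and "has_weak_cokernels D"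
    and "S \<subseteq> Obj D"
    and "closed_under_weak_cokernels D S"
    and "closed_under_direct_summands D S"
    and "precovering D S"
  shows "coreflective D S"
proof -
  interpret additive_linear_category R D
    by fact
  show ?thesis
    using assms by (intro coreflectiveI exists_coreflection_map)
qed

end
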